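(* For every integer $m\ge 1$ there exist constants $c_m>0$ and $a_m>0$ such that for all $n\ge 1$, \[sat(Q_n,Q_m)\le \frac{c_m}{n^{a_m}}\, e(Q_n),\] where one may take $a_1=1$ and $a_m=\frac{1}{7\cdot 3^{m-2}}$ for all $m>1$.
   Context: $Q_n$ is the $n$-dimensional hypercube: vertex set $\{0,1\}^n$, two vertices adjacent iff they differ in exactly one coordinate; $e(Q_n)=n2^{n-1}$. A copy of $F$ in $G$ is a subgraph of $G$ isomorphic to $F$; $G$ is $F$-free if it has no copy of $F$. A graph $G$ is $(Q_n,F)$-saturated if $G$ is a subgraph of $Q_n$, $G$ is $F$-free, and adding any edge of $E(Q_n)\setminus E(G)$ creates a copy of $F$. $sat(Q_n,F)$ is the minimum number of edges of a $(Q_n,F)$-saturated graph. *)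

theory Defs
  imports Complex_Main
begin

text \<open>Vertices of Q_n: subsets of {0..<n} (characteristic sets of 0/1 vectors).
  Two vertices are adjacent iff their symmetric difference has exactly one element.
  A subgraph of Q_n is represented by its edge set (edges are 2-element sets);
  its vertex set is taken to be all of V(Q_n), which is harmless since
  Q_m for m >= 1 has no isolated vertices.\<close>

definition hcube_verts :: "nat \<Rightarrow> nat set set" where
  "hcube_verts n = Pow {0..<n}"

definition hcube_adj :: "nat set \<Rightarrow> nat set \<Rightarrow> bool" where
  "hcube_adj u v \<longleftrightarrow> card ((u - v) \<union> (v - u)) = 1"

definition hcube_edges :: "nat \<Rightarrow> nat set set set" where
  "hcube_edges n = {{u, v} | u v. u \<in> hcube_verts n \<and> v \<in> hcube_verts n \<and> hcube_adj u v}"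

definition has_Qm_copy :: "nat \<Rightarrow> nat \<Rightarrow> nat set set set \<Rightarrow> bool" where
  "has_Qm_copy n m E \<longleftrightarrow>
     (\<exists>f. inj_on f (hcube_verts m) \<and> f ` hcube_verts m \<subseteq> hcube_verts n \<and>
          (\<forall>e \<in> hcube_edges m. f ` e \<in> E))"

definition Qsaturated :: "nat \<Rightarrow> nat \<Rightarrow> nat set set set \<Rightarrow> bool" where
  "Qsaturated n m E \<longleftrightarrow>
     E \<subseteq> hcube_edges n \<and> \<not> has_Qm_copy n m E \<and>
     (\<forall>e \<in> hcube_edges n - E. has_Qm_copy n m (insert e E))"

definition sat_Q :: "nat \<Rightarrow> nat \<Rightarrow> nat" where
  "sat_Q n m = Min {card E | E. Qsaturated n m E}"

definition a_exp :: "nat \<Rightarrow> real" where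
  "a_exp m = (if m = 1 then 1 else 1 / (7 * 3 ^ (m - 2)))"

end

theory Submission
  imports Defs
begin

text \<open>
  The bound proved is of order sqrt n * 2^n for every fixed m, by induction on m. Call a graph G
  cheap if it has few edges and only few missing edges fail to complete a copy of Q_m;
  extending a Q_m-free cheap G greedily to a maximal Q_m-free graph adds only such failing edges.

  For the step from m to m + 1, split the coordinates into A and its complement B, with
  |A| = (m + 1) 2^r of order sqrt n. Hamming codes on m + 1 blocks of A mark some vertices v of
  the A-cube as centres of types T v, a subset of {0..m}, such that unmarked vertices have exactly one
  neighbouring centre of each type. Above an unmarked vertex place the cheap graph for Q_m on B; above a
  centre of type t place all edges of the B-cube except those on levels congruent to t modulo m + 1;
  and join unmarked vertices to the adjacent centres. A copy of Q_m in the B-cube meets exactly m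
  consecutive levels, so it survives above the centres of exactly one type t. Hence an edge that
  completes a Q_m above an unmarked vertex completes a Q_(m+1) with the parallel cube above the
  neighbouring centre of type t. Conversely a Q_(m+1) uses at most one direction of A, because the
  join has no 4-cycle, and so it would put a Q_m above an unmarked vertex.
\<close>

section \<open>Flipping coordinates as symmetric difference\<close>

definition symdiff :: "'a set \<Rightarrow> 'a set \<Rightarrow> 'a set" (infixl "\<triangle>" 65) where
  "A \<triangle> B = (A - B) \<union> (B - A)"

lemma in_symdiff [simp]: "x \<in> A \<triangle> B \<longleftrightarrow> (x \<in> A) \<noteq> (x \<in> B)"
  by (auto simp: symdiff_def)

lemma symdiff_empty [simp]: "A \<triangle> {} = A"
  by (auto simp: symdiff_def)

lemma symdiff_cancel [simp]: "A \<triangle> B \<triangle> B = A"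
  by auto

lemma symdiff_assoc: "A \<triangle> B \<triangle> C = A \<triangle> (B \<triangle> C)"
  by auto

lemma symdiff_right_commute: "A \<triangle> B \<triangle> C = A \<triangle> C \<triangle> B"
  by auto

lemma symdiff_left_cancel: "A \<triangle> (A \<triangle> B) = B"
  by auto

lemma symdiff_eq_iff: "A \<triangle> B = A \<longleftrightarrow> B = {}" "A \<triangle> B = A \<triangle> C \<longleftrightarrow> B = C"
  using symdiff_left_cancel[of A B] symdiff_left_cancel[of A C] symdiff_left_cancel[of A "{}"]
  by (metis symdiff_empty)+

lemma symdiff_subset: "A \<subseteq> S \<Longrightarrow> B \<subseteq> S \<Longrightarrow> A \<triangle> B \<subseteq> S"
  unfolding symdiff_def by blast

text \<open>
  A subgraph of the cube on the coordinate set S is encoded by a predicate E, where E v d says that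
  the edge from v in direction d is present. Each edge thus has two encodings, (v, d) and
  (v \<triangle> {d}, d), which flip-invariance identifies.
\<close>

definition flip_invariant :: "'a set \<Rightarrow> ('a set \<Rightarrow> 'a \<Rightarrow> bool) \<Rightarrow> bool" where
  "flip_invariant S E \<longleftrightarrow> (\<forall>v\<subseteq>S. \<forall>d\<in>S. E (v \<triangle> {d}) d = E v d)"

lemma flip_invariantD: "flip_invariant S E \<Longrightarrow> v \<subseteq> S \<Longrightarrow> d \<in> S \<Longrightarrow> E (v \<triangle> {d}) d = E v d"
  unfolding flip_invariant_def by blast

text \<open>The base \<open>u\<close> may be any vertex of the subcube, not only its lowest one, and
  both encodings of every edge are tested.\<close>

definition spans_cube :: "('a set \<Rightarrow> 'a \<Rightarrow> bool) \<Rightarrow> 'a set \<Rightarrow> 'a set \<Rightarrow> bool" where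
  "spans_cube E u D \<longleftrightarrow> (\<forall>X\<subseteq>D. \<forall>d\<in>D. E (u \<triangle> X) d)"

definition cube_free :: "nat \<Rightarrow> 'a set \<Rightarrow> ('a set \<Rightarrow> 'a \<Rightarrow> bool) \<Rightarrow> bool" where
  "cube_free m S E \<longleftrightarrow> \<not> (\<exists>u\<subseteq>S. \<exists>D\<subseteq>S. card D = m \<and> spans_cube E u D)"

text \<open>Both encodings are added, so that flip-invariance is preserved.\<close>

definition add_edge :: "('a set \<Rightarrow> 'a \<Rightarrow> bool) \<Rightarrow> 'a set \<Rightarrow> 'a \<Rightarrow> 'a set \<Rightarrow> 'a \<Rightarrow> bool" where
  "add_edge E v d w e \<longleftrightarrow> E w e \<or> e = d \<and> (w = v \<or> w = v \<triangle> {d})"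

text \<open>Anchoring the subcube at \<open>v\<close> loses nothing: by
  \<open>spans_cube_shift\<close>, a subcube containing the edge can be re-based at any of its
  vertices.\<close>

definition completes :: "nat \<Rightarrow> 'a set \<Rightarrow> ('a set \<Rightarrow> 'a \<Rightarrow> bool) \<Rightarrow> 'a set \<Rightarrow> 'a \<Rightarrow> bool" where
  "completes m S E v d \<longleftrightarrow>
     (\<exists>D\<subseteq>S. card D = m \<and> d \<in> D \<and> spans_cube (add_edge E v d) v D)"

text \<open>These encode the only edges that a maximal Q_m-free extension of \<open>E\<close> can
  contain, so the size of this set bounds the saturation number. Counting both encodings costs at
  most a factor of 2.\<close>

definition cost :: "nat \<Rightarrow> 'a set \<Rightarrow> ('a set \<Rightarrow> 'a \<Rightarrow> bool) \<Rightarrow> ('a set \<times> 'a) set" where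
  "cost m S E = {(v, d). v \<subseteq> S \<and> d \<in> S \<and> (E v d \<or> \<not> completes m S E v d)}"

lemma cost_subset: "cost m S E \<subseteq> Pow S \<times> S"
  by (auto simp: cost_def)

lemma finite_cost: "finite S \<Longrightarrow> finite (cost m S E)"
  using cost_subset[of m S E] by (rule finite_subset) auto

lemma spans_cubeD: "spans_cube E u D \<Longrightarrow> X \<subseteq> D \<Longrightarrow> d \<in> D \<Longrightarrow> E (u \<triangle> X) d"
  unfolding spans_cube_def by blast

lemma spans_cube_baseD: "spans_cube E u D \<Longrightarrow> d \<in> D \<Longrightarrow> E u d"
  using spans_cubeD[of E u D "{}" d] by simp

lemma spans_cube_subset: "spans_cube E u D \<Longrightarrow> D' \<subseteq> D \<Longrightarrow> spans_cube E u D'"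
  unfolding spans_cube_def by blast

lemma spans_cube_shift:
  assumes "spans_cube E u D" and "Y \<subseteq> D"
  shows "spans_cube E (u \<triangle> Y) D"
  unfolding spans_cube_def
proof (intro allI impI ballI)
  fix X d assume "X \<subseteq> D" "d \<in> D"
  then have "E (u \<triangle> (Y \<triangle> X)) d"
    using spans_cubeD[OF assms(1) symdiff_subset[OF assms(2)]] by blast
  then show "E (u \<triangle> Y \<triangle> X) d" by (simp add: symdiff_assoc)
qed

subsection \<open>The induction step\<close>

text \<open>\<open>T\<close> depends only on the coordinates in \<open>A\<close>.
  \<open>T_no_C4\<close> forbids a 4-cycle in which two centres are both adjacent to the same two
  unmarked vertices.\<close>

locale lifted_cube =
  fixes S A :: "'a set" and T :: "'a set \<Rightarrow> nat set" and m :: nat and E :: "'a set \<Rightarrow> 'a \<Rightarrow> bool"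
  assumes finite_S: "finite S" and A_subset: "A \<subseteq> S"
    and T_range: "\<And>v. v \<subseteq> S \<Longrightarrow> T v \<subseteq> {..m}"
    and T_local: "\<And>v X. v \<subseteq> S \<Longrightarrow> X \<inter> A = {} \<Longrightarrow> T (v \<triangle> X) = T v"
    and T_dominating: "\<And>v t. v \<subseteq> S \<Longrightarrow> T v = {} \<Longrightarrow> t \<le> m \<Longrightarrow> \<exists>i\<in>A. T (v \<triangle> {i}) = {t}"
    and T_no_C4: "\<And>v i j t s. v \<subseteq> S \<Longrightarrow> T v = {} \<Longrightarrow> i \<in> A \<Longrightarrow> j \<in> A \<Longrightarrow> i \<noteq> j \<Longrightarrow>
        T (v \<triangle> {i}) = {t} \<Longrightarrow> T (v \<triangle> {j}) = {s} \<Longrightarrow> T (v \<triangle> {i} \<triangle> {j}) \<noteq> {}"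
    and E_inv: "flip_invariant (S - A) E"
    and E_free: "cube_free m (S - A) E"
begin

text \<open>\<open>card (v - A - {d})\<close> is the level, inside the cube on \<open>S - A\<close>,
  of the lower end of the edge; deleting \<open>d\<close> makes it the same from both ends. A vertex
  with two or more types keeps no edge, so only vertices of a single type act as centres.\<close>

definition L :: "'a set \<Rightarrow> 'a \<Rightarrow> bool" where
  "L v d \<longleftrightarrow>
     (if d \<in> A then T v = {} \<and> is_singleton (T (v \<triangle> {d})) \<or> is_singleton (T v) \<and> T (v \<triangle> {d}) = {}
      else if T v = {} then E (v - A) d
      else \<exists>t. T v = {t} \<and> card (v - A - {d}) mod (m + 1) \<noteq> t)"

lemma diff_symdiff: "X \<inter> A = {} \<Longrightarrow> (v \<triangle> X) - A = (v - A) \<triangle> X"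
  by auto

lemma L_inv: "flip_invariant S L"
  unfolding flip_invariant_def
proof (intro allI impI ballI)
  fix v d assume vd: "v \<subseteq> S" "d \<in> S"
  show "L (v \<triangle> {d}) d = L v d"
  proof (cases "d \<in> A")
    case True
    then show ?thesis unfolding L_def by (simp only: symdiff_cancel) auto
  next
    case False
    have "T (v \<triangle> {d}) = T v" using T_local[of v "{d}"] vd False by auto
    moreover have "(v \<triangle> {d}) - A - {d} = v - A - {d}" by auto
    moreover have "E ((v \<triangle> {d}) - A) d = E (v - A) d"
    proof -
      have "(v \<triangle> {d}) - A = (v - A) \<triangle> {d}" using False by auto
      then show ?thesis using flip_invariantD[OF E_inv, of "v - A" d] vd False by auto
    qed
    ultimately show ?thesis using False by (simp add: L_def)
  qed
qed

text \<open>An edge in a direction of \<open>A\<close> joins an unmarked vertex to a centre. Two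
  such directions at an unmarked \<open>w\<close> would give two centres and, opposite
  \<open>w\<close>, a second unmarked vertex, contrary to \<open>T_no_C4\<close>.\<close>

lemma L_one_A_direction:
  assumes u: "u \<subseteq> S" and sp: "spans_cube L u D" and ij: "i \<in> D \<inter> A" "j \<in> D \<inter> A"
  shows "i = j"
proof (rule ccontr)
  assume ne: "i \<noteq> j"
  \<comment> \<open>If \<open>u\<close> is marked, its neighbour in direction \<open>i\<close> is
    unmarked and lies in the same subcube.\<close>
  have "\<exists>w\<subseteq>S. T w = {} \<and> spans_cube L w D"
  proof (cases "T u = {}")
    case False
    have "L u i" using spans_cube_baseD[OF sp] ij by blast
    then have "T (u \<triangle> {i}) = {}" using ij False by (auto simp: L_def)
    moreover have "spans_cube L (u \<triangle> {i}) D" using spans_cube_shift[OF sp] ij by auto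
    moreover have "u \<triangle> {i} \<subseteq> S" using u ij A_subset by auto
    ultimately show ?thesis by blast
  qed (use u sp in blast)
  then obtain w where w: "w \<subseteq> S" "T w = {}" "spans_cube L w D" by blast
  have L1: "L w i" "L w j"
    using spans_cube_baseD[OF w(3)] ij by auto
  have L2: "L (w \<triangle> {i}) j"
    using spans_cubeD[OF w(3), of "{i}" j] ij by auto
  have 1: "is_singleton (T (w \<triangle> {i}))" "is_singleton (T (w \<triangle> {j}))"
    using L1 w(2) ij by (auto simp: L_def is_singleton_def)
  have "T (w \<triangle> {i} \<triangle> {j}) = {}"
    using L2 1 ij by (auto simp: L_def is_singleton_def)
  then show False using T_no_C4[OF w(1,2) _ _ ne] 1 ij by (auto simp: is_singleton_def)
qed

lemma spans_base:
  assumes "T u = {}" "u \<subseteq> S" "spans_cube L u D" "D \<inter> A = {}"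
  shows "spans_cube E (u - A) D"
  unfolding spans_cube_def
proof (intro allI impI ballI)
  fix X d assume X: "X \<subseteq> D" "d \<in> D"
  then have XA: "X \<inter> A = {}" "d \<notin> A" using assms(4) by auto
  have "L (u \<triangle> X) d" using spans_cubeD[OF assms(3) X] .
  then show "E ((u - A) \<triangle> X) d"
    using XA T_local[of u X] assms(1,2) by (auto simp: L_def diff_symdiff)
qed

text \<open>A cube of dimension \<open>m + 1\<close> has edges on \<open>m + 1\<close> consecutive
  levels, hence on every residue. Deleting one residue class above a centre therefore destroys
  it.\<close>

lemma level_cube_free:
  assumes "finite D" "card D = m + 1" "finite u" "t \<le> m"
  shows "\<exists>X\<subseteq>D. \<exists>d\<in>D. card ((u \<triangle> X) - {d}) mod (m + 1) = t"
proof -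
  \<comment> \<open>Modulo \<open>m + 1\<close> this is \<open>t - card (u - D)\<close>; the factor
    \<open>m\<close> acts as -1 and avoids subtraction of naturals.\<close>
  define j where "j = (t + m * card (u - D)) mod (m + 1)"
  have jm: "j \<le> m" unfolding j_def by (simp add: less_Suc_eq_le)
  obtain d where d: "d \<in> D" using assms(2) by fastforce
  have "card (D - {d}) = m" using assms d by simp
  then obtain Y where Y: "Y \<subseteq> D - {d}" "card Y = j"
    using obtain_subset_with_card_n[of j "D - {d}"] jm by auto
  have fY: "finite Y" using Y assms(1) by (meson finite_Diff finite_subset)
  \<comment> \<open>Chosen so that \<open>u \<triangle> X\<close> meets \<open>D\<close> exactly in
    \<open>Y\<close>.\<close>
  define X where "X = (u \<inter> D) \<triangle> Y"
  have "X \<subseteq> D" using Y by (auto simp: X_def)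
  have "(u \<triangle> X) - {d} = (u - D) \<union> Y" using Y d by (auto simp: X_def)
  moreover have "card ((u - D) \<union> Y) = card (u - D) + card Y"
    using Y(1) assms(3) fY by (intro card_Un_disjoint) auto
  ultimately have "card ((u \<triangle> X) - {d}) = card (u - D) + j"
    using Y(2) by simp
  moreover have "(card (u - D) + j) mod (m + 1) = (t + (m + 1) * card (u - D)) mod (m + 1)"
    unfolding j_def by (simp add: mod_add_right_eq algebra_simps)
  moreover have "(t + (m + 1) * card (u - D)) mod (m + 1) = t"
    using assms(4) by (simp only: mod_mult_self2) simp
  ultimately show ?thesis using \<open>X \<subseteq> D\<close> d by metis
qed

text \<open>From a cube containing an unmarked vertex, removing at most one direction of
  \<open>A\<close> leaves a Q_m inside \<open>E\<close>. A cube without unmarked vertices uses no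
  direction of \<open>A\<close> and sits above a single centre, where the deleted levels break
  it.\<close>

lemma L_free: "cube_free (m + 1) S L"
  unfolding cube_free_def
proof (intro notI, elim exE conjE)
  fix u D assume u: "u \<subseteq> S" and D: "D \<subseteq> S" "card D = m + 1" and sp: "spans_cube L u D"
  have fin: "finite D" "finite u" using u D finite_S finite_subset by auto
  have base: False if "w \<subseteq> S" "T w = {}" "spans_cube L w D" for w
  proof -
    have "\<exists>D'\<subseteq>D. D' \<inter> A = {} \<and> card D' = m"
    proof (cases "D \<inter> A = {}")
      case True
      then show ?thesis using obtain_subset_with_card_n[of m D] D(2) by (metis Int_mono le_add1 subset_empty order_refl)
    next
      case False
      then obtain i where i: "i \<in> D \<inter> A" by blast
      then have "(D - {i}) \<inter> A = {}" using L_one_A_direction[OF u sp] by blast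
      moreover have "card (D - {i}) = m" using i D fin by simp
      ultimately show ?thesis by blast
    qed
    then obtain D' where D': "D' \<subseteq> D" "D' \<inter> A = {}" "card D' = m" by blast
    have "spans_cube E (w - A) D'"
      using spans_base[OF that(2,1) spans_cube_subset[OF that(3) D'(1)] D'(2)] .
    moreover have "w - A \<subseteq> S - A" "D' \<subseteq> S - A" using that D' D by auto
    ultimately show False using E_free D'(3) unfolding cube_free_def by blast
  qed
  show False
  proof (cases "T u = {}")
    case True
    then show False using base u sp by blast
  next
    case Tu: False
    show False
    proof (cases "D \<inter> A = {}")
      case False
      then obtain i where i: "i \<in> D \<inter> A" by blast
      have "L u i" using spans_cube_baseD[OF sp] i by blast
      then have "T (u \<triangle> {i}) = {}" using i Tu by (auto simp: L_def)
      moreover have "spans_cube L (u \<triangle> {i}) D" using spans_cube_shift[OF sp] i by auto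
      moreover have "u \<triangle> {i} \<subseteq> S" using u i A_subset by auto
      ultimately show False using base by blast
    next
      case True
      obtain d0 where d0: "d0 \<in> D" using D by fastforce
      \<comment> \<open>Without directions of \<open>A\<close> the type is constant on the cube, and
        the presence of edges forces it to be a singleton.\<close>
      have key: "\<exists>t. T u = {t} \<and> card ((u - A) \<triangle> X - {d}) mod (m + 1) \<noteq> t" if X: "X \<subseteq> D" "d \<in> D" for X d
      proof -
        have XA: "X \<inter> A = {}" "d \<notin> A" using X True by auto
        have "L (u \<triangle> X) d" using spans_cubeD[OF sp X] .
        then show ?thesis using XA Tu T_local[OF u XA(1)] by (auto simp: L_def diff_symdiff)
      qed
      from key[OF _ d0, of "{}"] obtain t where t: "T u = {t}" by auto
      have "t \<le> m" using T_range[of u] t u by auto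
      then obtain X d where "X \<subseteq> D" "d \<in> D" "card ((u - A) \<triangle> X - {d}) mod (m + 1) = t"
        using level_cube_free[OF fin(1) D(2), of "u - A" t] fin by blast
      with key[of X d] t show False by simp
    qed
  qed
qed

text \<open>The subcube above \<open>v\<close> is doubled in a direction \<open>i\<close> that leads
  to a centre. The copy above \<open>v\<close> lacks at most the new edge, and the copy above
  \<open>v \<triangle> {i}\<close> is complete because it avoids the deleted levels.\<close>

lemma completes_L:
  assumes v: "v \<subseteq> S" and Tv: "T v = {}" and d: "d \<in> S - A"
    and compl: "completes m (S - A) E (v - A) d"
  shows "completes (m + 1) S L v d"
proof -
  obtain D where D: "D \<subseteq> S - A" "card D = m" "d \<in> D" "spans_cube (add_edge E (v - A) d) (v - A) D"
    using compl unfolding completes_def by blast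
  have fD: "finite D" using D(1) finite_S finite_subset by blast
  have fv: "finite v" using v finite_S finite_subset by blast
  define a where "a = card (v - A - D)"
  \<comment> \<open>The edges of the cube spanned by D lie on levels a, ..., a + m - 1, so exactly the
    centres of the type t below contain all of it.\<close>
  define t where "t = (a + m) mod (m + 1)"
  have "t \<le> m" by (simp add: t_def less_Suc_eq_le)
  then obtain i where i: "i \<in> A" "T (v \<triangle> {i}) = {t}" using T_dominating[OF v Tv] by blast
  have iD: "i \<notin> D" using i D(1) by blast
  \<comment> \<open>The lower end of such an edge has level \<open>a + card Y\<close> with
    \<open>card Y < m\<close>, as \<open>Y\<close> omits \<open>e\<close>. It differs from
    \<open>a + m\<close> by at least 1 and at most \<open>m\<close>, never by a multiple of
    \<open>m + 1\<close>.\<close>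
  have level: "card ((v - A) \<triangle> X - {e}) mod (m + 1) \<noteq> t" if X: "X \<subseteq> D" "e \<in> D" for X e
  proof -
    define Y where "Y = ((v - A) \<triangle> X - {e}) \<inter> D"
    have "(v - A) \<triangle> X - {e} = (v - A - D) \<union> Y" using X by (auto simp: Y_def)
    moreover have "card ((v - A - D) \<union> Y) = a + card Y"
      unfolding a_def using fv fD by (intro card_Un_disjoint) (auto simp: Y_def)
    moreover have "card Y < m"
      using psubset_card_mono[OF fD, of Y] X D(2) by (auto simp: Y_def)
    ultimately have c: "card ((v - A) \<triangle> X - {e}) = a + card Y" "card Y < m" by auto
    show ?thesis
    proof
      assume "card ((v - A) \<triangle> X - {e}) mod (m + 1) = t"
      then have "(a + m) mod (m + 1) = (a + card Y) mod (m + 1)" using c by (simp add: t_def)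
      then have "(m + 1) dvd (a + m) - (a + card Y)" by (rule mod_eq_dvd_iff_nat[THEN iffD1, rotated]) (use c in auto)
      then have "(m + 1) dvd m - card Y" by simp
      then show False using c(2) by (auto dest!: dvd_imp_le)
    qed
  qed
  have "spans_cube (add_edge L v d) v (insert i D)"
    unfolding spans_cube_def
  proof (intro allI impI ballI)
    fix X e assume X: "X \<subseteq> insert i D" and e: "e \<in> insert i D"
    \<comment> \<open>\<open>X'\<close> moves inside one of the two parallel cubes; whether
      \<open>X\<close> contains \<open>i\<close> tells which one.\<close>
    define X' where "X' = X - {i}"
    have X': "X' \<subseteq> D" "X' \<inter> A = {}" using X D(1) by (auto simp: X'_def)
    have Xcases: "X = X' \<or> X = {i} \<triangle> X'" by (auto simp: X'_def)
    have T0: "T (v \<triangle> X') = {}" using T_local[OF v X'(2)] Tv by simp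
    have vi: "v \<triangle> {i} \<subseteq> S" using v i A_subset by auto
    have T1: "T (v \<triangle> {i} \<triangle> X') = {t}" using T_local[OF vi X'(2)] i by simp
    show "add_edge L v d (v \<triangle> X) e"
    proof (cases "e = i")
      case True
      have "L (v \<triangle> X') i" "L (v \<triangle> {i} \<triangle> X') i"
        using T0 T1 i by (simp_all add: L_def symdiff_right_commute[of v "{i}" X'])
      then show ?thesis using Xcases True by (auto simp: add_edge_def symdiff_assoc)
    next
      case False
      then have eD: "e \<in> D" and eA: "e \<notin> A" using e D(1) by auto
      from Xcases show ?thesis
      proof
        assume XX: "X = X'"
        have "add_edge E (v - A) d ((v - A) \<triangle> X') e" using spans_cubeD[OF D(4) X'(1) eD] .
        then consider "E ((v - A) \<triangle> X') e" | "e = d" "X' = {} \<or> X' = {d}"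
          unfolding add_edge_def by (auto simp: symdiff_eq_iff)
        then show ?thesis
        proof cases
          case 1
          then have "L (v \<triangle> X') e" using T0 eA diff_symdiff[OF X'(2)] by (simp add: L_def)
          then show ?thesis using XX by (simp add: add_edge_def)
        next
          case 2
          then show ?thesis using XX by (auto simp: add_edge_def)
        qed
      next
        assume XX: "X = {i} \<triangle> X'"
        have "(v \<triangle> {i} \<triangle> X') - A = (v - A) \<triangle> X'" using X'(2) i by auto
        then have "L (v \<triangle> {i} \<triangle> X') e" using T1 level[OF X'(1) eD] eA by (simp add: L_def)
        then show ?thesis using XX by (simp add: add_edge_def symdiff_assoc)
      qed
    qed
  qed
  moreover have "card (insert i D) = m + 1" using iD fD D(2) by simp
  moreover have "insert i D \<subseteq> S" using D(1) i A_subset by auto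
  ultimately show ?thesis using D(3) unfolding completes_def by blast
qed

text \<open>\<open>C1\<close> holds the pairs with a direction in \<open>A\<close>, and
  \<open>C2\<close> those at a marked vertex. By \<open>completes_L\<close>, any other pair in the
  cost projects to a pair in the cost of \<open>E\<close>; \<open>C3\<close> has one copy of these
  for each vertex of the cube on \<open>A\<close>.\<close>

lemma card_cost_L:
  "card (cost (m + 1) S L) \<le> card A * 2 ^ card S + card S * card {v. v \<subseteq> S \<and> T v \<noteq> {}}
     + 2 ^ card A * card (cost m (S - A) E)"
proof -
  define C1 where "C1 = Pow S \<times> A"
  define C2 where "C2 = {v. v \<subseteq> S \<and> T v \<noteq> {}} \<times> S"
  define C3 where "C3 = (\<lambda>(w, v, d). (w \<union> v, d)) ` (Pow A \<times> cost m (S - A) E)"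
  have fin: "finite A" "finite (cost m (S - A) E)" "finite C2"
    using A_subset finite_S finite_subset finite_cost[of "S - A"] by (auto simp: C2_def)
  have "cost (m + 1) S L \<subseteq> C1 \<union> C2 \<union> C3"
  proof
    fix p assume "p \<in> cost (m + 1) S L"
    then obtain v d where p: "p = (v, d)" "v \<subseteq> S" "d \<in> S" "L v d \<or> \<not> completes (m + 1) S L v d"
      unfolding cost_def by blast
    show "p \<in> C1 \<union> C2 \<union> C3"
    proof (cases "d \<in> A \<or> T v \<noteq> {}")
      case True
      then show ?thesis using p by (auto simp: C1_def C2_def)
    next
      case False
      then have d: "d \<in> S - A" and Tv: "T v = {}" using p by auto
      have "E (v - A) d \<or> \<not> completes m (S - A) E (v - A) d"
        using p(4) completes_L[OF p(2) Tv d] Tv d by (auto simp: L_def)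
      then have "(v - A, d) \<in> cost m (S - A) E" using p d by (auto simp: cost_def)
      then have "(v \<inter> A, v - A, d) \<in> Pow A \<times> cost m (S - A) E" by auto
      moreover have "p = (\<lambda>(w, v, d). (w \<union> v, d)) (v \<inter> A, v - A, d)"
        using p(1) by auto
      ultimately have "p \<in> C3" unfolding C3_def by (rule rev_image_eqI)
      then show ?thesis by blast
    qed
  qed
  moreover have "finite (C1 \<union> C2 \<union> C3)"
    using fin finite_S by (auto simp: C1_def C3_def)
  ultimately have "card (cost (m + 1) S L) \<le> card (C1 \<union> C2 \<union> C3)" by (rule card_mono[rotated])
  also have "\<dots> \<le> card C1 + card C2 + card C3"
    by (meson add_mono card_Un_le le_trans order_refl)
  also have "card C1 = card A * 2 ^ card S"
    using finite_S by (simp add: C1_def card_cartesian_product card_Pow mult.commute)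
  also have "card C2 = card S * card {v. v \<subseteq> S \<and> T v \<noteq> {}}"
    by (simp add: C2_def card_cartesian_product)
  also have "card C3 \<le> card (Pow A \<times> cost m (S - A) E)"
    unfolding C3_def using fin by (intro card_image_le) auto
  also have "\<dots> = 2 ^ card A * card (cost m (S - A) E)"
    using fin by (simp add: card_cartesian_product card_Pow)
  finally show ?thesis by simp
qed

end

subsection \<open>Hamming codes\<close>

text \<open>Averaging over the fibres of \<open>f\<close>. It selects a sparse coset of each Hamming
  code without computing the sizes of the cosets.\<close>

lemma exists_rare_value:
  assumes "finite X" "finite K" "K \<noteq> {}" "f ` X \<subseteq> K"
  shows "\<exists>c\<in>K. card K * card {x\<in>X. f x = c} \<le> card X"
proof (rule ccontr)
  assume "\<not> ?thesis"
  then have *: "card X < card K * card {x\<in>X. f x = c}" if "c \<in> K" for c using that by force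
  have "card K * card X = (\<Sum>c\<in>K. card X)" by simp
  also have "\<dots> < (\<Sum>c\<in>K. card K * card {x\<in>X. f x = c})"
    using assms * by (intro sum_strict_mono) auto
  also have "\<dots> = card K * (\<Sum>c\<in>K. card {x\<in>X. f x = c})" by (simp add: sum_distrib_left)
  also have "(\<Sum>c\<in>K. card {x\<in>X. f x = c}) = card (\<Union>c\<in>K. {x\<in>X. f x = c})"
    using assms by (intro card_UN_disjoint[symmetric]) auto
  also have "(\<Union>c\<in>K. {x\<in>X. f x = c}) = X" using assms by auto
  finally show False by simp
qed

text \<open>The columns \<open>h i\<close> are 0/1 vectors written as sets of positions. For finite
  \<open>x\<close> this is the sum modulo 2 of the columns indexed by \<open>x\<close>, the parity
  check of a linear code.\<close>

definition syndrome :: "('a \<Rightarrow> nat set) \<Rightarrow> 'a set \<Rightarrow> nat set" where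
  "syndrome h x = {b. odd (card {i \<in> x. b \<in> h i})}"

lemma syndrome_flip:
  assumes "finite x"
  shows "syndrome h (x \<triangle> {i}) = syndrome h x \<triangle> h i"
proof -
  have "odd (card {j \<in> x \<triangle> {i}. b \<in> h j}) \<longleftrightarrow> odd (card {j \<in> x. b \<in> h j}) \<noteq> (b \<in> h i)" for b
  proof (cases "b \<in> h i")
    case False
    then have "{j \<in> x \<triangle> {i}. b \<in> h j} = {j \<in> x. b \<in> h j}" by auto
    then show ?thesis using False by simp
  next
    case True
    show ?thesis
    proof (cases "i \<in> x")
      case ix: True
      have "{j \<in> x. b \<in> h j} = insert i {j \<in> x \<triangle> {i}. b \<in> h j}" using True ix by auto
      moreover have "finite {j \<in> x \<triangle> {i}. b \<in> h j}" using assms by (auto simp: symdiff_def)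
      ultimately have "card {j \<in> x. b \<in> h j} = Suc (card {j \<in> x \<triangle> {i}. b \<in> h j})"
        using ix by simp
      then show ?thesis using True by simp
    next
      case ix: False
      have "{j \<in> x \<triangle> {i}. b \<in> h j} = insert i {j \<in> x. b \<in> h j}" using True ix by auto
      then have "card {j \<in> x \<triangle> {i}. b \<in> h j} = Suc (card {j \<in> x. b \<in> h j})"
        using ix assms by simp
      then show ?thesis using True by simp
    qed
  qed
  then show ?thesis unfolding syndrome_def by (intro set_eqI) simp
qed

lemma syndrome_cong: "(\<And>i. i \<in> x \<triangle> y \<Longrightarrow> h i = {}) \<Longrightarrow> syndrome h x = syndrome h y"
  unfolding syndrome_def
  by (intro Collect_cong arg_cong[where f = "\<lambda>A. odd (card A)"]) auto

lemma syndrome_subset: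
  assumes "\<And>i. i \<in> x \<Longrightarrow> h i \<subseteq> K"
  shows "syndrome h x \<subseteq> K"
proof
  fix b assume "b \<in> syndrome h x"
  then have "odd (card {i \<in> x. b \<in> h i})" by (simp add: syndrome_def)
  moreover have "card {i \<in> x. b \<in> h i} = 0" if "{i \<in> x. b \<in> h i} = {}"
    unfolding that by simp
  ultimately have "{i \<in> x. b \<in> h i} \<noteq> {}" by fastforce
  with assms show "b \<in> K" by blast
qed

text \<open>Block \<open>t\<close> of \<open>A\<close> has one coordinate for every 0/1 vector of
  length \<open>r\<close>, zero included, so exactly one flip in the block turns the syndrome
  \<open>f t v\<close> into \<open>c t\<close>. Flips in other blocks do not affect it. Domination
  and the absence of 4-cycles both follow.\<close>

lemma exists_type_function:
  fixes S A :: "'a set"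
  assumes fin: "finite S" and A: "A \<subseteq> S" and cardA: "card A = (m + 1) * 2 ^ r"
  obtains T :: "'a set \<Rightarrow> nat set" where
    "\<And>v. T v \<subseteq> {..m}"
    "\<And>v X. X \<inter> A = {} \<Longrightarrow> T (v \<triangle> X) = T v"
    "\<And>v t. v \<subseteq> S \<Longrightarrow> T v = {} \<Longrightarrow> t \<le> m \<Longrightarrow> \<exists>i\<in>A. T (v \<triangle> {i}) = {t}"
    "\<And>v i j t s. v \<subseteq> S \<Longrightarrow> T v = {} \<Longrightarrow> i \<in> A \<Longrightarrow> j \<in> A \<Longrightarrow> i \<noteq> j \<Longrightarrow>
        T (v \<triangle> {i}) = {t} \<Longrightarrow> T (v \<triangle> {j}) = {s} \<Longrightarrow> T (v \<triangle> {i} \<triangle> {j}) \<noteq> {}"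
    "2 ^ r * card {v. v \<subseteq> S \<and> T v \<noteq> {}} \<le> (m + 1) * 2 ^ card S"
proof -
  define K where "K = Pow {..<r}"
  have K: "finite K" "K \<noteq> {}" "card K = 2 ^ r" by (auto simp: K_def card_Pow)
  have "card A = card ({..m} \<times> K)" using cardA K by (simp add: card_cartesian_product)
  then obtain g where g: "bij_betw g A ({..m} \<times> K)"
    using finite_same_card_bij[of A "{..m} \<times> K"] K fin A finite_subset by auto
  define h where "h t i = (if i \<in> A \<and> fst (g i) = t then snd (g i) else {})" for t i
  define f where "f t v = syndrome (h t) v" for t v
  have fK: "f t v \<in> K" for t v
  proof -
    have "h t i \<subseteq> {..<r}" for i
      using bij_betwE[OF g] unfolding h_def K_def by (cases "i \<in> A") (auto simp: mem_Times_iff)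
    then show ?thesis unfolding f_def K_def using syndrome_subset[of v "h t" "{..<r}"] by blast
  qed
  \<comment> \<open>Each code is replaced by a coset of density at most \<open>1 / 2 ^ r\<close>,
    which keeps the number of marked vertices small.\<close>
  have "\<exists>c\<in>K. card K * card {v\<in>Pow S. f t v = c} \<le> card (Pow S)" for t
    using fin K fK by (intro exists_rare_value) auto
  then obtain c where c: "\<And>t. c t \<in> K" "\<And>t. card K * card {v\<in>Pow S. f t v = c t} \<le> card (Pow S)"
    by metis
  define T where "T v = {t. t \<le> m \<and> f t v = c t}" for v
  have finv: "finite v" if "v \<subseteq> S" for v using that fin finite_subset by blast
  have fi: "f t (v \<triangle> {i}) = f t v \<triangle> snd (g i)" if "v \<subseteq> S" "i \<in> A" "fst (g i) = t" for v i t
    using syndrome_flip[OF finv[OF that(1)]] that by (simp add: f_def h_def)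
  have fo: "f t (v \<triangle> {i}) = f t v" if "v \<subseteq> S" "fst (g i) \<noteq> t" for v i t
    using syndrome_flip[OF finv[OF that(1)]] that by (simp add: f_def h_def)
  show thesis
  proof
    show "T v \<subseteq> {..m}" for v by (auto simp: T_def)
    show "T (v \<triangle> X) = T v" if "X \<inter> A = {}" for v X
    proof -
      have "f t (v \<triangle> X) = f t v" for t
        unfolding f_def by (rule syndrome_cong) (use that in \<open>auto simp: h_def\<close>)
      then show ?thesis by (simp add: T_def)
    qed
    show "\<exists>i\<in>A. T (v \<triangle> {i}) = {t}" if v: "v \<subseteq> S" "T v = {}" "t \<le> m" for v t
    proof -
      \<comment> \<open>The column to be flipped is the difference between the syndrome and its
        target.\<close>
      have "f t v \<triangle> c t \<in> K" using fK[of t v] c(1)[of t] unfolding K_def by auto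
      then obtain i where i: "i \<in> A" "g i = (t, f t v \<triangle> c t)"
        using g v(3) unfolding bij_betw_def by (metis (no_types, lifting) SigmaI atMost_iff imageE)
      have "f t (v \<triangle> {i}) = f t v \<triangle> (f t v \<triangle> c t)"
        using fi[OF v(1) i(1), of t] i(2) by simp
      also have "\<dots> = c t" by auto
      finally have "f t (v \<triangle> {i}) = c t" .
      moreover have "f s (v \<triangle> {i}) \<noteq> c s" if "s \<le> m" "s \<noteq> t" for s
      proof -
        have "f s v \<noteq> c s" using v(2) that(1) by (auto simp: T_def)
        moreover have "f s (v \<triangle> {i}) = f s v" using fo[OF v(1), of i s] i(2) that(2) by simp
        ultimately show ?thesis by simp
      qed
      ultimately have "T (v \<triangle> {i}) = {t}" using v(3) by (auto simp: T_def)
      with i show ?thesis by blast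
    qed
    show "T (v \<triangle> {i} \<triangle> {j}) \<noteq> {}"
      if v: "v \<subseteq> S" "T v = {}" and ij: "i \<in> A" "j \<in> A" "i \<noteq> j"
        and Ti: "T (v \<triangle> {i}) = {t}" and Tj: "T (v \<triangle> {j}) = {s}" for v i j t s
    proof -
      have st: "t \<le> m" "s \<le> m" "f t v \<noteq> c t" "f s v \<noteq> c s"
          "f t (v \<triangle> {i}) = c t" "f s (v \<triangle> {j}) = c s"
        using Ti Tj v(2) by (auto simp: T_def set_eq_iff)
      \<comment> \<open>A flip outside block \<open>t\<close> cannot change its syndrome from a
        wrong value to \<open>c t\<close>.\<close>
      have gi: "fst (g i) = t" using fo[OF v(1), of i t] st by auto
      have gj: "fst (g j) = s" using fo[OF v(1), of j s] st by auto
      \<comment> \<open>Within one block both flips would use the correcting column, which only one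
        coordinate has.\<close>
      have "s \<noteq> t"
      proof
        assume "s = t"
        then have "f t v \<triangle> snd (g i) = f t v \<triangle> snd (g j)"
          using fi[OF v(1) ij(1) gi] fi[OF v(1) ij(2) gj] st by simp
        then have "g i = g j" using gi gj \<open>s = t\<close> by (simp add: symdiff_eq_iff prod_eq_iff)
        then show False using g ij unfolding bij_betw_def inj_on_def by blast
      qed
      moreover have "v \<triangle> {i} \<subseteq> S" using v ij A by auto
      \<comment> \<open>Flipping \<open>j\<close> in another block leaves the syndrome of block
        \<open>t\<close> at \<open>c t\<close>, so \<open>t\<close> survives in the type.\<close>
      ultimately have "f t (v \<triangle> {i} \<triangle> {j}) = c t" using fo[of "v \<triangle> {i}" j t] gj st by simp
      then show ?thesis using st by (auto simp: T_def)
    qed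
    have "{v. v \<subseteq> S \<and> T v \<noteq> {}} = (\<Union>t\<in>{..m}. {v\<in>Pow S. f t v = c t})" by (auto simp: T_def)
    then have "card {v. v \<subseteq> S \<and> T v \<noteq> {}} \<le> (\<Sum>t\<le>m. card {v\<in>Pow S. f t v = c t})"
      using card_UN_le[of "{..m}" "\<lambda>t. {v\<in>Pow S. f t v = c t}"] by simp
    then have "2 ^ r * card {v. v \<subseteq> S \<and> T v \<noteq> {}} \<le> (\<Sum>t\<le>m. card K * card {v\<in>Pow S. f t v = c t})"
      unfolding K by (simp add: sum_distrib_left[symmetric])
    also have "\<dots> \<le> (\<Sum>t\<le>m. card (Pow S))" by (intro sum_mono c(2))
    also have "\<dots> = (m + 1) * 2 ^ card S" using fin by (simp add: card_Pow)
    finally show "2 ^ r * card {v. v \<subseteq> S \<and> T v \<noteq> {}} \<le> (m + 1) * 2 ^ card S" .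
  qed
qed

section \<open>The base case: the empty graph and Q_1\<close>

lemma empty_graph_cube_free: "m \<ge> 1 \<Longrightarrow> cube_free m S (\<lambda>v d. False)"
  unfolding cube_free_def spans_cube_def by fastforce

text \<open>A single edge already is a Q_1, so no missing edge fails to complete one.\<close>

lemma cost_1_empty_graph: "cost 1 S (\<lambda>v d. False) = {}"
proof -
  have "completes 1 S (\<lambda>v d. False) v d" if "d \<in> S" for v d
    unfolding completes_def
  proof (intro exI[of _ "{d}"] conjI)
    show "spans_cube (add_edge (\<lambda>v d. False) v d) v {d}"
      unfolding spans_cube_def add_edge_def by (auto simp: subset_singleton_iff)
  qed (use that in auto)
  then show ?thesis by (auto simp: cost_def)
qed

subsection \<open>Transfer to subgraphs of the hypercube\<close>

lemma hcube_adj_iff: "hcube_adj u v \<longleftrightarrow> (\<exists>d. v = u \<triangle> {d})"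
proof
  assume "hcube_adj u v"
  then obtain d where "u \<triangle> v = {d}"
    unfolding hcube_adj_def symdiff_def by (auto simp: card_1_singleton_iff)
  then show "\<exists>d. v = u \<triangle> {d}" by (metis symdiff_left_cancel)
next
  assume "\<exists>d. v = u \<triangle> {d}"
  then obtain d where "v = u \<triangle> {d}" by blast
  then have "u \<triangle> v = {d}" by (simp add: symdiff_left_cancel)
  then show "hcube_adj u v" by (simp add: hcube_adj_def symdiff_def)
qed

definition flip_edge :: "nat set \<Rightarrow> nat \<Rightarrow> nat set set" where
  "flip_edge v d = {v, v \<triangle> {d}}"

lemma hcube_edges_eq: "hcube_edges n = {flip_edge v d | v d. v \<subseteq> {0..<n} \<and> d \<in> {0..<n}}"
proof (intro equalityI subsetI)
  fix e assume "e \<in> hcube_edges n"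
  then obtain u d where u: "u \<subseteq> {0..<n}" "u \<triangle> {d} \<subseteq> {0..<n}" "e = {u, u \<triangle> {d}}"
    unfolding hcube_edges_def hcube_verts_def by (auto simp: hcube_adj_iff)
  then have "d \<in> {0..<n}" using in_symdiff[of d u "{d}"] by blast
  then show "e \<in> {flip_edge v d | v d. v \<subseteq> {0..<n} \<and> d \<in> {0..<n}}"
    using u unfolding flip_edge_def by blast
next
  fix e assume "e \<in> {flip_edge v d | v d. v \<subseteq> {0..<n} \<and> d \<in> {0..<n}}"
  then obtain v d where v: "v \<subseteq> {0..<n}" "d \<in> {0..<n}" "e = {v, v \<triangle> {d}}"
    unfolding flip_edge_def by blast
  then have "v \<triangle> {d} \<subseteq> {0..<n}" by (intro symdiff_subset) auto
  then show "e \<in> hcube_edges n"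
    using v unfolding hcube_edges_def hcube_verts_def hcube_adj_iff by blast
qed

lemma finite_hcube_edges: "finite (hcube_edges n)"
proof -
  have "hcube_edges n \<subseteq> (\<lambda>(v, d). flip_edge v d) ` (Pow {0..<n} \<times> {0..<n})"
    unfolding hcube_edges_eq by auto
  then show ?thesis by (rule finite_subset) auto
qed

text \<open>Each edge is recorded once, by its direction \<open>d\<close> and its lower end, which
  omits \<open>d\<close>; the injectivity of this record gives the bound.\<close>

lemma card_hcube_edges: "n * 2 ^ (n - 1) \<le> card (hcube_edges n)"
proof -
  define P where "P = (SIGMA d:{0..<n}. Pow ({0..<n} - {d}))"
  have "inj_on (\<lambda>(d, v). {v, insert d v}) P"
  proof (rule inj_onI, clarify)
    fix d v e w assume "(d, v) \<in> P" "(e, w) \<in> P" and eq: "{v, insert d v} = {w, insert e w}"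
    then have nin: "d \<notin> v" "e \<notin> w" by (auto simp: P_def)
    from eq have "v = w \<and> insert d v = insert e w \<or> v = insert e w \<and> insert d v = w"
      by (simp add: doubleton_eq_iff)
    then show "d = e \<and> v = w" using nin by blast
  qed
  moreover have "(\<lambda>(d, v). {v, insert d v}) ` P \<subseteq> hcube_edges n"
  proof
    fix e assume "e \<in> (\<lambda>(d, v). {v, insert d v}) ` P"
    then obtain d v where *: "d \<in> {0..<n}" "v \<subseteq> {0..<n} - {d}" "e = {v, insert d v}"
      unfolding P_def by blast
    then have "insert d v = v \<triangle> {d}" by (auto simp: symdiff_def)
    then show "e \<in> hcube_edges n" using * unfolding hcube_edges_eq flip_edge_def by blast
  qed
  ultimately have "card P \<le> card (hcube_edges n)"
    by (rule card_inj_on_le[OF _ _ finite_hcube_edges])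
  moreover have "card P = n * 2 ^ (n - 1)"
    unfolding P_def by (subst card_SigmaI) (auto simp: card_Pow)
  ultimately show ?thesis by simp
qed

definition graph_edges :: "nat \<Rightarrow> (nat set \<Rightarrow> nat \<Rightarrow> bool) \<Rightarrow> nat set set set" where
  "graph_edges n E = {flip_edge v d | v d. v \<subseteq> {0..<n} \<and> d \<in> {0..<n} \<and> E v d}"

lemma graph_edges_subset: "graph_edges n E \<subseteq> hcube_edges n"
  unfolding graph_edges_def hcube_edges_eq by blast

lemma flip_edge_eqD: "flip_edge v d = flip_edge w e \<Longrightarrow> d = e \<and> (w = v \<or> w = v \<triangle> {d})"
proof -
  assume "flip_edge v d = flip_edge w e"
  then have "v = w \<and> v \<triangle> {d} = w \<triangle> {e} \<or> v = w \<triangle> {e} \<and> v \<triangle> {d} = w"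
    by (simp add: flip_edge_def doubleton_eq_iff)
  then show ?thesis
  proof (elim disjE conjE)
    assume "v = w" "v \<triangle> {d} = w \<triangle> {e}"
    then have "v \<triangle> {d} = v \<triangle> {e}" by metis
    then have "{d} = {e}" by (simp only: symdiff_eq_iff)
    then show ?thesis using \<open>v = w\<close> by simp
  next
    assume *: "v = w \<triangle> {e}" "v \<triangle> {d} = w"
    then have "w \<triangle> {d} = w \<triangle> {e}" using symdiff_cancel[of v "{d}"] by metis
    then have "{d} = {e}" by (simp only: symdiff_eq_iff)
    then show ?thesis using * by simp
  qed
qed

lemma flip_edge_in_graph_edges:
  assumes "flip_invariant {0..<n} E" and "v \<subseteq> {0..<n}" "d \<in> {0..<n}"
  shows "flip_edge v d \<in> graph_edges n E \<longleftrightarrow> E v d"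
proof
  assume "flip_edge v d \<in> graph_edges n E"
  then obtain w e where w: "flip_edge v d = flip_edge w e" "E w e"
    unfolding graph_edges_def by blast
  from flip_edge_eqD[OF w(1)] have "e = d" and "w = v \<or> w = v \<triangle> {d}" by blast+
  then show "E v d" using w(2) flip_invariantD[OF assms] by metis
next
  assume "E v d"
  then show "flip_edge v d \<in> graph_edges n E" using assms(2,3) unfolding graph_edges_def by blast
qed

section \<open>Copies of Q_m and spanned subcubes\<close>

lemma image_symdiff:
  assumes "inj_on g C" "A \<subseteq> C" "B \<subseteq> C"
  shows "g ` (A \<triangle> B) = g ` A \<triangle> g ` B"
proof -
  have "A - B \<subseteq> C" "B - A \<subseteq> C" using assms by auto
  then show ?thesis
    unfolding symdiff_def image_Un using assms inj_on_image_set_diff[OF assms(1)] by simp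
qed

text \<open>\<open>has_Qm_copy\<close> allows any injective edge-preserving map, but each such map
  sends \<open>X\<close> to the vertex obtained from \<open>u\<close> by flipping the coordinates
  \<open>g i\<close> with \<open>i\<close> in \<open>X\<close>. The directions at \<open>u\<close>
  determine everything else, since two vertices at distance two have only two common
  neighbours.\<close>

lemma embedding_spans_cube:
  assumes inv: "flip_invariant {0..<n} E" and copy: "has_Qm_copy n m (graph_edges n E)"
  shows "\<not> cube_free m {0..<n} E"
proof -
  obtain f where inj: "inj_on f (Pow {0..<m})" and fv: "f ` Pow {0..<m} \<subseteq> Pow {0..<n}"
    and fe: "\<And>e. e \<in> hcube_edges m \<Longrightarrow> f ` e \<in> graph_edges n E"
    using copy unfolding has_Qm_copy_def hcube_verts_def by (elim exE conjE) simp
  have step: "\<exists>d\<in>{0..<n}. f (X \<triangle> {i}) = f X \<triangle> {d}" if "X \<subseteq> {0..<m}" "i \<in> {0..<m}" for X i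
  proof -
    have "flip_edge X i \<in> hcube_edges m" using that unfolding hcube_edges_eq by blast
    from fe[OF this] obtain v d where "d \<in> {0..<n}" "{f X, f (X \<triangle> {i})} = {v, v \<triangle> {d}}"
      unfolding graph_edges_def by (auto simp: flip_edge_def)
    then show ?thesis by (metis doubleton_eq_iff symdiff_cancel)
  qed
  define u where "u = f {}"
  have "\<forall>i\<in>{0..<m}. \<exists>d\<in>{0..<n}. f {i} = u \<triangle> {d}"
  proof
    fix i assume "i \<in> {0..<m}"
    then have "\<exists>d\<in>{0..<n}. f ({} \<triangle> {i}) = f {} \<triangle> {d}" by (intro step) auto
    moreover have "{} \<triangle> {i} = {i}" by (auto simp: symdiff_def)
    ultimately show "\<exists>d\<in>{0..<n}. f {i} = u \<triangle> {d}" by (simp add: u_def)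
  qed
  then obtain g where g: "\<And>i. i < m \<Longrightarrow> g i \<in> {0..<n} \<and> f {i} = u \<triangle> {g i}"
    by (metis atLeastLessThan_iff le0)
  have injg: "inj_on g {0..<m}"
  proof (rule inj_onI)
    fix i j assume ij: "i \<in> {0..<m}" "j \<in> {0..<m}" "g i = g j"
    then have "f {i} = f {j}" using g by simp
    then have "{i} = {j}" using inj_onD[OF inj, of "{i}" "{j}"] ij by blast
    then show "i = j" by simp
  qed
  have fX: "f X = u \<triangle> g ` X" if "X \<subseteq> {0..<m}" for X
  proof -
    have "finite X" using that finite_subset by blast
    then show ?thesis using that
    proof (induction X rule: finite_psubset_induct)
      case (psubset X)
      consider "X = {}" | i where "X = {i}" | i j where "i \<in> X" "j \<in> X" "i \<noteq> j"
        by (metis is_singletonI' is_singleton_def)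
      then show ?case
      proof cases
        case 1
        then show ?thesis by (simp add: u_def)
      next
        case 2
        then show ?thesis using g psubset.prems by simp
      next
        case 3
        \<comment> \<open>\<open>f X\<close> is a common neighbour of \<open>f (X - {i})\<close> and
          \<open>f (X - {j})\<close>. The only ones are \<open>f Y\<close> and the vertex opposite
          it in their 4-cycle, and injectivity excludes \<open>f Y\<close>.\<close>
        define Y where "Y = X - {i, j}"
        have sub: "X - {i} \<subset> X" "X - {j} \<subset> X" "Y \<subset> X" using 3 by (auto simp: Y_def)
        have IH: "f (X - {i}) = u \<triangle> g ` (X - {i})" "f (X - {j}) = u \<triangle> g ` (X - {j})" "f Y = u \<triangle> g ` Y"
          using psubset.IH[OF sub(1)] psubset.IH[OF sub(2)] psubset.IH[OF sub(3)] psubset.prems sub by blast+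
        have mem: "i \<in> {0..<m}" "j \<in> {0..<m}" "Y \<subseteq> {0..<m}" using 3 psubset.prems by (auto simp: Y_def)
        have gij: "g i \<noteq> g j" using injg 3(3) mem by (meson inj_onD)
        have gY: "g i \<notin> g ` Y" "g j \<notin> g ` Y" using injg mem by (auto simp: Y_def dest: inj_onD)
        define W where "W = u \<triangle> g ` Y"
        have im: "g ` (X - {i}) = g ` Y \<triangle> {g j}" "g ` (X - {j}) = g ` Y \<triangle> {g i}"
            "g ` X = g ` Y \<triangle> {g j} \<triangle> {g i}"
        proof -
          have "X - {i} = insert j Y" "X - {j} = insert i Y" "X = insert j (insert i Y)"
            using 3 by (auto simp: Y_def)
          then have "g ` (X - {i}) = insert (g j) (g ` Y)" "g ` (X - {j}) = insert (g i) (g ` Y)"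
            "g ` X = insert (g j) (insert (g i) (g ` Y))" by (metis image_insert)+
          then show "g ` (X - {i}) = g ` Y \<triangle> {g j}" "g ` (X - {j}) = g ` Y \<triangle> {g i}"
            "g ` X = g ` Y \<triangle> {g j} \<triangle> {g i}" using gY gij by (auto simp: symdiff_def)
        qed
        have fi: "f (X - {i}) = W \<triangle> {g j}" and fj: "f (X - {j}) = W \<triangle> {g i}"
          using IH im by (simp_all add: W_def symdiff_assoc)
        have "X - {i} \<triangle> {i} = X" "X - {j} \<triangle> {j} = X" using 3 by auto
        then obtain a b where a: "f X = W \<triangle> {g j} \<triangle> {a}" and b: "f X = W \<triangle> {g i} \<triangle> {b}"
          using step[of "X - {i}" i] step[of "X - {j}" j] fi fj mem psubset.prems by (metis Diff_subset subset_trans)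
        then have "{g j} \<triangle> {a} = {g i} \<triangle> {b}" by (simp add: symdiff_assoc symdiff_eq_iff)
        then have "a = g j \<or> a = g i" using gij unfolding symdiff_def by blast
        moreover have "a \<noteq> g j"
        proof
          assume "a = g j"
          then have "f X = f Y" using a IH(3) by (simp add: W_def)
          then have "X = Y" using inj_onD[OF inj, of X Y] mem psubset.prems by blast
          then show False using sub by blast
        qed
        ultimately have "f X = W \<triangle> {g j} \<triangle> {g i}" using a by blast
        then show ?thesis unfolding im(3) W_def by (simp add: symdiff_assoc)
      qed
    qed
  qed
  define D where "D = g ` {0..<m}"
  have "card D = m" unfolding D_def using injg by (simp add: card_image)
  moreover have "D \<subseteq> {0..<n}" unfolding D_def using g by auto
  moreover have u: "u \<subseteq> {0..<n}" using fv by (auto simp: u_def)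
  moreover have "spans_cube E u D"
    unfolding spans_cube_def
  proof (intro allI impI ballI)
    fix X d assume "X \<subseteq> D" "d \<in> D"
    then obtain Y i where Y: "Y \<subseteq> {0..<m}" "X = g ` Y" and i: "i \<in> {0..<m}" "d = g i"
      unfolding D_def by (metis subset_imageE image_iff)
    obtain e where e: "f (Y \<triangle> {i}) = f Y \<triangle> {e}" using step[OF Y(1) i(1)] by blast
    have Yi: "Y \<triangle> {i} \<subseteq> {0..<m}" using Y i by (intro symdiff_subset) auto
    have "g ` (Y \<triangle> {i}) = g ` Y \<triangle> g ` {i}"
      using Y i by (intro image_symdiff[OF injg]) auto
    then have "f (Y \<triangle> {i}) = f Y \<triangle> {d}" using fX[OF Y(1)] fX[OF Yi] i by (simp add: symdiff_assoc)
    then have "f ` flip_edge Y i = flip_edge (f Y) d" by (simp add: flip_edge_def)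
    moreover have "flip_edge Y i \<in> hcube_edges m" using Y i unfolding hcube_edges_eq by blast
    ultimately have "flip_edge (f Y) d \<in> graph_edges n E" using fe by metis
    moreover have "f Y \<subseteq> {0..<n}" using fv Y by blast
    moreover have "d \<in> {0..<n}" using i g by auto
    ultimately have "E (f Y) d" using flip_edge_in_graph_edges[OF inv] by blast
    then show "E (u \<triangle> X) d" using fX[OF Y(1)] Y by simp
  qed
  ultimately show ?thesis unfolding cube_free_def by blast
qed

lemma completes_has_Qm_copy:
  assumes v: "v \<subseteq> {0..<n}" and c: "completes m {0..<n} E v d"
  shows "has_Qm_copy n m (insert (flip_edge v d) (graph_edges n E))"
proof -
  obtain D where D: "D \<subseteq> {0..<n}" "card D = m" "spans_cube (add_edge E v d) v D"
    using c unfolding completes_def by blast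
  have "finite D" using D(1) finite_subset by blast
  then obtain g where g: "bij_betw g {0..<m} D"
    using D(2) ex_bij_betw_nat_finite by metis
  define f where "f Y = v \<triangle> g ` Y" for Y
  have gi: "inj_on g {0..<m}" and gD: "g ` {0..<m} = D" using g by (auto simp: bij_betw_def)
  show ?thesis
    unfolding has_Qm_copy_def hcube_verts_def
  proof (intro exI[of _ f] conjI ballI)
    show "inj_on f (Pow {0..<m})"
      using inj_on_image_Pow[OF gi] unfolding inj_on_def f_def by (simp add: symdiff_eq_iff)
    show "f ` Pow {0..<m} \<subseteq> Pow {0..<n}"
    proof (intro image_subsetI PowI)
      fix Y assume "Y \<in> Pow {0..<m}"
      then have "g ` Y \<subseteq> {0..<n}" using gD D(1) by blast
      then show "f Y \<subseteq> {0..<n}" unfolding f_def using v by (intro symdiff_subset)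
    qed
    fix e assume "e \<in> hcube_edges m"
    then obtain Y i where Y: "Y \<subseteq> {0..<m}" "i \<in> {0..<m}" "e = flip_edge Y i"
      unfolding hcube_edges_eq by blast
    have "g ` (Y \<triangle> {i}) = g ` Y \<triangle> g ` {i}"
      using Y by (intro image_symdiff[OF gi]) auto
    then have fe: "f ` e = flip_edge (f Y) (g i)"
      using Y(3) by (simp add: flip_edge_def f_def symdiff_assoc)
    have gY: "g ` Y \<subseteq> D" "g i \<in> D" using Y gD by auto
    have "add_edge E v d (f Y) (g i)" using spans_cubeD[OF D(3) gY] by (simp add: f_def)
    then consider "E (f Y) (g i)" | "g i = d" "f Y = v \<or> f Y = v \<triangle> {d}"
      unfolding add_edge_def by blast
    then show "f ` e \<in> insert (flip_edge v d) (graph_edges n E)"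
    proof cases
      case 1
      have "g ` Y \<subseteq> {0..<n}" "g i \<in> {0..<n}" using gY D(1) by blast+
      then have "f Y \<subseteq> {0..<n}" unfolding f_def by (intro symdiff_subset[OF v])
      then have "flip_edge (f Y) (g i) \<in> graph_edges n E"
        using 1 \<open>g i \<in> {0..<n}\<close> unfolding graph_edges_def by blast
      then show ?thesis using fe by simp
    next
      case 2
      \<comment> \<open>The two encodings of the new edge denote the same edge.\<close>
      have "flip_edge (v \<triangle> {d}) d = flip_edge v d"
        by (simp add: flip_edge_def insert_commute)
      then have "f ` e = flip_edge v d" using 2 unfolding fe by metis
      then show ?thesis by blast
    qed
  qed
qed

lemma has_Qm_copy_mono: "has_Qm_copy n m E \<Longrightarrow> E \<subseteq> E' \<Longrightarrow> has_Qm_copy n m E'"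
  unfolding has_Qm_copy_def by (erule ex_forward) auto

text \<open>A maximal Q_m-free graph containing \<open>E\<close> is saturated. None of its edges
  completes a Q_m over \<open>E\<close>, since that copy would lie inside it; so all of them are
  encoded in the cost.\<close>

lemma sat_Q_le_card_cost:
  assumes inv: "flip_invariant {0..<n} E" and free: "cube_free m {0..<n} E"
  shows "sat_Q n m \<le> card (cost m {0..<n} E)"
proof -
  define F where "F = {H. H \<subseteq> hcube_edges n \<and> \<not> has_Qm_copy n m H}"
  have "finite F" using finite_hcube_edges[of n] by (auto simp: F_def)
  moreover have "graph_edges n E \<in> F"
    using embedding_spans_cube[OF inv] free graph_edges_subset by (auto simp: F_def)
  ultimately obtain G where G: "G \<in> F" "graph_edges n E \<subseteq> G" "\<And>H. H \<in> F \<Longrightarrow> G \<subseteq> H \<Longrightarrow> G = H"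
    using finite_has_maximal2[of F] by metis
  have "Qsaturated n m G"
    unfolding Qsaturated_def
  proof (intro conjI ballI)
    fix e assume e: "e \<in> hcube_edges n - G"
    show "has_Qm_copy n m (insert e G)"
    proof (rule ccontr)
      assume "\<not> has_Qm_copy n m (insert e G)"
      then have "insert e G \<in> F" using e G(1) by (auto simp: F_def)
      then show False using G(3)[of "insert e G"] e by blast
    qed
  qed (use G(1) in \<open>auto simp: F_def\<close>)
  moreover have "finite {card H | H. Qsaturated n m H}"
  proof (rule finite_subset)
    show "{card H | H. Qsaturated n m H} \<subseteq> card ` Pow (hcube_edges n)"
      unfolding Qsaturated_def by blast
  qed (use finite_hcube_edges in blast)
  ultimately have "sat_Q n m \<le> card G" unfolding sat_Q_def by (intro Min_le) auto
  also have "G \<subseteq> (\<lambda>(v, d). flip_edge v d) ` cost m {0..<n} E"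
  proof
    fix e assume e: "e \<in> G"
    then obtain v d where v: "v \<subseteq> {0..<n}" "d \<in> {0..<n}" "e = flip_edge v d"
      using G(1) unfolding F_def hcube_edges_eq by blast
    have "\<not> completes m {0..<n} E v d"
    proof
      assume "completes m {0..<n} E v d"
      from completes_has_Qm_copy[OF v(1) this] have "has_Qm_copy n m G"
        by (rule has_Qm_copy_mono) (use e v(3) G(2) in auto)
      then show False using G(1) by (simp add: F_def)
    qed
    then have "(v, d) \<in> cost m {0..<n} E" using v by (simp add: cost_def)
    then show "e \<in> (\<lambda>(v, d). flip_edge v d) ` cost m {0..<n} E" using v(3) by force
  qed
  then have "card G \<le> card (cost m {0..<n} E)"
    by (meson card_image_le card_mono finite_atLeastLessThan finite_cost finite_imageI le_trans)
  finally show ?thesis .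
qed

subsection \<open>The main bound\<close>

text \<open>The claim ranges over all finite coordinate sets \<open>S\<close> so that the induction
  hypothesis applies to \<open>S - A\<close>.\<close>

lemma exists_sparse_graph:
  assumes "m \<ge> 1"
  shows "\<exists>c\<ge>0. \<forall>S::'a set. finite S \<longrightarrow> (\<exists>E. flip_invariant S E \<and> cube_free m S E \<and>
           real (card (cost m S E)) \<le> c * sqrt (card S) * 2 ^ card S)"
  using assms
proof (induction m rule: nat_induct_at_least)
  case base
  have "\<exists>E. flip_invariant S E \<and> cube_free 1 S E \<and>
           real (card (cost 1 S E)) \<le> 0 * sqrt (card S) * 2 ^ card S" for S :: "'a set"
    using empty_graph_cube_free[of 1 S]
    by (intro exI[of _ "\<lambda>v d. False"]) (simp add: flip_invariant_def cost_1_empty_graph del: One_nat_def)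
  then show ?case by (intro exI[of _ 0]) blast
next
  case (Suc m)
  then obtain c where c: "c \<ge> 0" "\<And>S::'a set. finite S \<Longrightarrow> \<exists>E. flip_invariant S E \<and> cube_free m S E \<and>
           real (card (cost m S E)) \<le> c * sqrt (card S) * 2 ^ card S" by blast
  \<comment> \<open>\<open>c\<close> comes from the graph on \<open>S - A\<close>, one multiple of
    \<open>m + 1\<close> from the edges in directions of \<open>A\<close>, and two from the edges at
    marked vertices.\<close>
  define c' where "c' = c + 3 * (real m + 1)"
  have "\<exists>E. flip_invariant S E \<and> cube_free (m + 1) S E \<and>
           real (card (cost (m + 1) S E)) \<le> c' * sqrt (card S) * 2 ^ card S" if fin: "finite S" for S :: "'a set"
  proof -
    define n where "n = card S"
    have sq: "sqrt n * sqrt n = n" by simp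
    show ?thesis
    \<comment> \<open>For small \<open>n\<close> there may be no room for \<open>A\<close>, but then
      the total \<open>n * 2 ^ n\<close> is at most \<open>(m + 1) * sqrt n * 2 ^ n\<close>.\<close>
    proof (cases "sqrt n < m + 1")
      case True
      let ?E = "\<lambda>(v::'a set) (d::'a). False"
      have "card (cost (m + 1) S ?E) \<le> card (Pow S \<times> S)"
        using fin by (intro card_mono cost_subset) auto
      also have "\<dots> = n * 2 ^ n" using fin by (simp add: card_cartesian_product card_Pow n_def)
      finally have "real (card (cost (m + 1) S ?E)) \<le> real (n * 2 ^ n)" by (rule of_nat_mono)
      also have "\<dots> = sqrt n * sqrt n * 2 ^ n" by simp
      also have "\<dots> \<le> c' * sqrt n * 2 ^ n"
        using True c(1) by (intro mult_right_mono) (auto simp: c'_def)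
      finally show ?thesis
        using empty_graph_cube_free[of "m + 1" S] unfolding n_def
        by (intro exI[of _ ?E]) (simp add: flip_invariant_def)
    next
      case False
      define k where "k = nat \<lfloor>sqrt n\<rfloor>"
      have k: "real k \<le> sqrt n" "sqrt n < real k + 1" 
      proof -
        have "real k = of_int \<lfloor>sqrt n\<rfloor>" by (simp add: k_def)
        then show "real k \<le> sqrt n" "sqrt n < real k + 1" by linarith+
      qed
      have "k \<ge> 1" using False k by linarith
      \<comment> \<open>\<open>2 ^ r\<close> is the largest power of two not exceeding
        \<open>sqrt n\<close>, hence within a factor 2 of it.\<close>
      then obtain r where r: "2 ^ r \<le> k" "k < 2 ^ (r + 1)" using ex_power_ivl1[of 2 k] by auto
      have N: "2 ^ r \<le> sqrt n" "sqrt n \<le> 2 * 2 ^ r"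
      proof -
        have "(2::real) ^ r \<le> real k"
          using of_nat_mono[OF r(1), where 'a = real] by (simp only: of_nat_power of_nat_numeral)
        then show "2 ^ r \<le> sqrt n" using k by linarith
        have "k + 1 \<le> 2 * 2 ^ r" using r(2) by simp
        then have "real (k + 1) \<le> real (2 * 2 ^ r)" by (rule of_nat_mono)
        then have "real k + 1 \<le> 2 * 2 ^ r"
          by (simp only: of_nat_add of_nat_mult of_nat_power of_nat_numeral of_nat_1)
        then show "sqrt n \<le> 2 * 2 ^ r" using k by linarith
      qed
      \<comment> \<open>Room for \<open>A\<close>: both factors are at most
        \<open>sqrt n\<close>.\<close>
      have "(real m + 1) * 2 ^ r \<le> sqrt n * sqrt n"
      proof (rule mult_mono)
        show "real m + 1 \<le> sqrt n" using False by linarith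
      qed (use N(1) in simp_all)
      then have "real ((m + 1) * 2 ^ r) \<le> real n"
        unfolding sq by (simp add: algebra_simps)
      then have "(m + 1) * 2 ^ r \<le> card S" unfolding n_def by (simp only: of_nat_le_iff)
      then obtain A where A: "A \<subseteq> S" "card A = (m + 1) * 2 ^ r"
        by (meson obtain_subset_with_card_n)
      obtain T :: "'a set \<Rightarrow> nat set" where T:
        "\<And>v. T v \<subseteq> {..m}"
        "\<And>v X. X \<inter> A = {} \<Longrightarrow> T (v \<triangle> X) = T v"
        "\<And>v t. v \<subseteq> S \<Longrightarrow> T v = {} \<Longrightarrow> t \<le> m \<Longrightarrow> \<exists>i\<in>A. T (v \<triangle> {i}) = {t}"
        "\<And>v i j t s. v \<subseteq> S \<Longrightarrow> T v = {} \<Longrightarrow> i \<in> A \<Longrightarrow> j \<in> A \<Longrightarrow> i \<noteq> j \<Longrightarrow>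
            T (v \<triangle> {i}) = {t} \<Longrightarrow> T (v \<triangle> {j}) = {s} \<Longrightarrow> T (v \<triangle> {i} \<triangle> {j}) \<noteq> {}"
        and centres: "2 ^ r * card {v. v \<subseteq> S \<and> T v \<noteq> {}} \<le> (m + 1) * 2 ^ card S"
        using exists_type_function[OF fin A] by blast
      obtain E where E: "flip_invariant (S - A) E" "cube_free m (S - A) E"
        "real (card (cost m (S - A) E)) \<le> c * sqrt (card (S - A)) * 2 ^ card (S - A)"
        using c(2)[of "S - A"] fin by blast
      interpret lifted_cube S A T m E
        using fin A(1) T E(1,2) by unfold_locales
      define z where "z = card {v. v \<subseteq> S \<and> T v \<noteq> {}}"
      have cA: "card A \<le> n" "card (S - A) = n - card A"
        using A(1) fin unfolding n_def by (auto simp: card_mono card_Diff_subset finite_subset)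
      have b1: "real (card A * 2 ^ n) \<le> (real m + 1) * sqrt n * 2 ^ n"
      proof -
        have "real (card A) = (real m + 1) * 2 ^ r" using A(2) by (simp add: algebra_simps)
        also have "\<dots> \<le> (real m + 1) * sqrt n" using N(1) by (intro mult_left_mono) auto
        finally show ?thesis by (simp add: mult_right_mono)
      qed
      \<comment> \<open>Marked vertices have density at most \<open>(m + 1) / 2 ^ r\<close>, which
        is at most \<open>2 * (m + 1) / sqrt n\<close>, and each accounts for \<open>n\<close>
        pairs.\<close>
      have b2: "real (n * z) \<le> 2 * (real m + 1) * sqrt n * 2 ^ n"
      proof -
        have "real (2 ^ r * z) \<le> real ((m + 1) * 2 ^ n)"
          using centres unfolding z_def n_def by (rule of_nat_mono)
        then have z: "2 ^ r * real z \<le> (real m + 1) * 2 ^ n" by (simp add: algebra_simps)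
        have "real (n * z) = sqrt n * (sqrt n * real z)" by (simp add: mult.assoc[symmetric])
        also have "\<dots> \<le> sqrt n * (2 * 2 ^ r * real z)"
          using N(2) by (intro mult_left_mono mult_right_mono) auto
        also have "\<dots> = 2 * sqrt n * (2 ^ r * real z)" by simp
        also have "\<dots> \<le> 2 * sqrt n * ((real m + 1) * 2 ^ n)"
          using z by (intro mult_left_mono) auto
        finally show ?thesis by (simp add: algebra_simps)
      qed
      \<comment> \<open>The \<open>2 ^ card A\<close> copies of the smaller cube have
        \<open>2 ^ n\<close> vertices in total, and the square root does not increase on passing to
        \<open>S - A\<close>, so the constant \<open>c\<close> is kept.\<close>
      have b3: "real (2 ^ card A * card (cost m (S - A) E)) \<le> c * sqrt n * 2 ^ n"
      proof -
        have "real (2 ^ card A * card (cost m (S - A) E)) = 2 ^ card A * real (card (cost m (S - A) E))"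
          by simp
        also have "\<dots> \<le> 2 ^ card A * (c * sqrt (n - card A) * 2 ^ (n - card A))"
          using E(3) cA by (intro mult_left_mono) auto
        also have "\<dots> = c * sqrt (n - card A) * (2 ^ card A * 2 ^ (n - card A))" by simp
        also have "2 ^ card A * 2 ^ (n - card A) = (2 ^ n :: real)"
          using cA(1) by (simp add: power_add[symmetric])
        also have "c * sqrt (n - card A) * 2 ^ n \<le> c * sqrt n * 2 ^ n"
          using c(1) cA(1) by (intro mult_right_mono mult_left_mono) auto
        finally show ?thesis .
      qed
      have "real (card (cost (m + 1) S L)) \<le> real (card A * 2 ^ n + n * z + 2 ^ card A * card (cost m (S - A) E))"
        using card_cost_L unfolding n_def z_def by (rule of_nat_mono)
      also have "\<dots> \<le> c' * sqrt n * 2 ^ n"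
        using b1 b2 b3 by (simp add: c'_def algebra_simps)
      finally show ?thesis using L_inv L_free unfolding n_def by blast
    qed
  qed
  moreover have "c' \<ge> 0" using c(1) by (simp add: c'_def)
  ultimately show ?case by (intro exI[of _ c']) simp
qed

text \<open>\<open>sqrt n * 2 ^ n\<close> has the order of
  \<open>card (hcube_edges n) / sqrt n\<close>. This suffices for \<open>m > 1\<close>, where the
  exponent is at most 1/7; for \<open>m = 1\<close> the saturation number is 0.\<close>

theorem theorem1:
  fixes m :: nat
  assumes "m \<ge> 1"
  shows "\<exists>c > 0. \<forall>n \<ge> 1.
           real (sat_Q n m) \<le> c / (real n powr a_exp m) * real (card (hcube_edges n))"
proof (cases "m = 1")
  case True
  have "sat_Q n 1 = 0" for n
  proof -
    have "sat_Q n 1 \<le> card (cost 1 {0..<n} (\<lambda>v d. False))"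
      using empty_graph_cube_free[of 1 "{0..<n}"]
      by (intro sat_Q_le_card_cost) (auto simp: flip_invariant_def)
    then show ?thesis unfolding cost_1_empty_graph by simp
  qed
  then show ?thesis unfolding True by (intro exI[of _ 1]) simp
next
  case False
  obtain c where c: "c \<ge> 0" "\<And>S::nat set. finite S \<Longrightarrow> \<exists>E. flip_invariant S E \<and> cube_free m S E \<and>
      real (card (cost m S E)) \<le> c * sqrt (card S) * 2 ^ card S"
    using exists_sparse_graph[OF assms] by blast
  \<comment> \<open>The factor 2 turns \<open>2 ^ n\<close> into the \<open>2 ^ (n - 1)\<close> of
    the edge count; adding 1 keeps the constant positive when \<open>c = 0\<close>.\<close>
  have "real (sat_Q n m) \<le> (2 * c + 1) / (real n powr a_exp m) * real (card (hcube_edges n))"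
    if n: "n \<ge> 1" for n
  proof -
    obtain E where E: "flip_invariant {0..<n} E" "cube_free m {0..<n} E"
      "real (card (cost m {0..<n} E)) \<le> c * sqrt n * 2 ^ n"
      using c(2)[of "{0..<n}"] by auto
    have "(1::real) \<le> 3 ^ (m - 2)" by simp
    then have "(2::real) \<le> 7 * 3 ^ (m - 2)" by linarith
    then have "a_exp m \<le> 1 / 2" using False by (simp add: a_exp_def field_simps)
    then have "real n powr a_exp m \<le> real n powr (1 / 2)" using n by (intro powr_mono) auto
    also have "\<dots> = sqrt n" by (simp add: powr_half_sqrt)
    finally have pw: "real n powr a_exp m \<le> sqrt n" .
    have "real (sat_Q n m) \<le> real (card (cost m {0..<n} E))"
      using sat_Q_le_card_cost[OF E(1,2)] by simp
    also note E(3)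
    also have "c * sqrt n * 2 ^ n \<le> (2 * c + 1) * sqrt n * 2 ^ (n - 1)"
    proof -
      have "(2::real) ^ n = 2 * 2 ^ (n - 1)" using n by (cases n) auto
      then have "c * sqrt n * 2 ^ n = (2 * c) * sqrt n * 2 ^ (n - 1)" by simp
      also have "\<dots> \<le> (2 * c + 1) * sqrt n * 2 ^ (n - 1)" by (intro mult_right_mono) auto
      finally show ?thesis .
    qed
    also have "\<dots> = (2 * c + 1) / sqrt n * (real n * 2 ^ (n - 1))"
    proof -
      have "(2 * c + 1) / sqrt n * (real n * 2 ^ (n - 1)) = (2 * c + 1) * (n / sqrt n) * 2 ^ (n - 1)"
        by (simp only: times_divide_eq_left times_divide_eq_right mult.assoc)
      then show ?thesis by (simp only: real_div_sqrt[OF of_nat_0_le_iff])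
    qed
    also have "\<dots> \<le> (2 * c + 1) / (real n powr a_exp m) * (real n * 2 ^ (n - 1))"
      using pw c(1) n by (intro mult_right_mono divide_left_mono) auto
    also have "\<dots> \<le> (2 * c + 1) / (real n powr a_exp m) * real (card (hcube_edges n))"
    proof (rule mult_left_mono)
      have "real (n * 2 ^ (n - 1)) \<le> real (card (hcube_edges n))"
        using card_hcube_edges by (rule of_nat_mono)
      then show "real n * 2 ^ (n - 1) \<le> real (card (hcube_edges n))" by simp
    qed (use c(1) in auto)
    finally show ?thesis .
  qed
  then show ?thesis using c(1) by (intro exI[of _ "2 * c + 1"]) auto
qed

end
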